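(* Let $\ell\ge 3$ and $1\le r\le\lfloor\frac{\ell+3}{4}\rfloor$ be integers. Then the encoding map $\phi:\{0,1\}^{k_{\ell,r}}\to\{0,1\}^{2^\ell}$ associated with the sequence $f_{\ell,r}$ is one-to-one.
   Context: For integers $\ell\ge 3$ and $1\le r\le\lfloor\frac{\ell+3}{4}\rfloor$, the integer sequence $f_{\ell,r}(1),\dots,f_{\ell,r}(\ell)$ is defined by $f_{\ell,r}(1)=r+\delta(\ell,r)$; $f_{\ell,r}(i)=r+i-1$ for $2\le i\le \ell-2r-1$; $f_{\ell,r}(i)=\ell-1-\lceil\frac{\ell-i}{2}\rceil$ for $\ell-2r\le i\le\ell-1$; $f_{\ell,r}(\ell)=\ell$, where $\delta(\ell,r)=1$ if $\ell>2r+2$ and $\delta(\ell,r)=0$ otherwise (i.e. for $r=1,\ell\in\{3,4\}$ and $r=2,\ell\in\{5,6\}$). (When $\ell-2r=1$ the first and third formulas agree at $i=1$.) Put $k_{\ell,r}=\sum_{i=1}^\ell f_{\ell,r}(i)$. For a binary vector $\mathbf{y}$, $\mathrm{dec}(\mathbf{y})$ is its decimal value, most significant bit first. Encoding map $\phi$ associated with $s_\ell=f_{\ell,r}$, with $n=2^\ell$: write $\mathbf{x}=\mathbf{x}_\ell\Vert\mathbf{x}_{\ell-1}\Vert\cdots\Vert\mathbf{x}_1$ (concatenation) with $|\mathbf{x}_i|=s_\ell(i)$. Start with $\mathbf{c}=0^n$ (coordinates indexed $0,\dots,n-1$) and $\mathrm{pos}=-1$. For $j=\ell,\ell-1,\dots,1$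 in this order, replace $\mathrm{pos}$ by $(\mathrm{pos}+1+\mathrm{dec}(\mathbf{x}_j)) \bmod n$ and set $c[\mathrm{pos}]=1$. The output is $\phi(\mathbf{x})=\mathbf{c}$. *)

theory Defs
  imports Complex_Main
begin

definition delta :: "nat \<Rightarrow> nat \<Rightarrow> nat" where
  "delta l r = (if l > 2 * r + 2 then 1 else 0)"

text \<open>
  Only the values at \<open>1 \<le> i \<le> l\<close> are meaningful. For \<open>l \<ge> 3\<close> and \<open>1 \<le> r \<le> (l + 3) div 4\<close> we have
  \<open>2 * r < l\<close>, so no natural-number subtraction truncates in the clause where it is used. If
  \<open>l - 2 * r = 1\<close>, the first and third formulas agree at \<open>i = 1\<close>.
\<close>

definition f_seq :: "nat \<Rightarrow> nat \<Rightarrow> nat \<Rightarrow> nat" where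
  "f_seq l r i =
    (if i = 1 then r + delta l r
     else if 2 \<le> i \<and> i \<le> l - 2 * r - 1 then r + i - 1
     else if l - 2 * r \<le> i \<and> i \<le> l - 1 then l - 1 - nat \<lceil>(real l - real i) / 2\<rceil>
     else l)"

definition k_sum :: "nat \<Rightarrow> nat \<Rightarrow> nat" where
  "k_sum l r = (\<Sum>i=1..l. f_seq l r i)"

text \<open>Binary vectors are Boolean lists; \<open>horner_sum\<close> is least significant bit first, hence \<open>rev\<close>.\<close>

definition binvecs :: "nat \<Rightarrow> bool list set" where
  "binvecs n = {x. length x = n}"

definition dec :: "bool list \<Rightarrow> nat" where
  "dec y = horner_sum of_bool 2 (rev y)"

text \<open>
  The block \<open>x\<^sub>j\<close> of length \<open>s j\<close> in \<open>x = x\<^sub>l @ \<dots> @ x\<^sub>1\<close>: it is preceded by the blocks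
  with indices \<open>l, \<dots>, j + 1\<close>.
\<close>

definition block :: "(nat \<Rightarrow> nat) \<Rightarrow> nat \<Rightarrow> bool list \<Rightarrow> nat \<Rightarrow> bool list" where
  "block s l x j = take (s j) (drop (\<Sum>i=j+1..l. s i) x)"

definition enc_step ::
    "(nat \<Rightarrow> nat) \<Rightarrow> nat \<Rightarrow> bool list \<Rightarrow> nat \<Rightarrow> bool list \<times> int \<Rightarrow> bool list \<times> int" where
  "enc_step s l x j = (\<lambda>(c, pos).
     let pos' = (pos + 1 + int (dec (block s l x j))) mod 2 ^ l
     in (c[nat pos' := True], pos'))"

definition phi :: "(nat \<Rightarrow> nat) \<Rightarrow> nat \<Rightarrow> bool list \<Rightarrow> bool list" where
  "phi s l x = fst (fold (enc_step s l x) (rev [1..<l+1]) (replicate (2 ^ l) False, -1))"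

end

theory Submission
  imports Defs
begin

text \<open>
  Seen from the first position written, the \<open>l\<close> positions have strictly increasing offsets below
  \<open>2 ^ l\<close>, so the positions together with the first one determine all blocks. If a codeword arose
  from two different first positions, \<open>t > 0\<close> steps apart, then splitting the cycle of gaps at
  these two positions bounds every gap, the closing one included, by a block bound:
  \<open>2 ^ l\<close> is at most \<open>\<Sum>i\<le>l-t. 2 ^ s i + \<Sum>i\<le>t. 2 ^ s i\<close>. Since \<open>s\<close> is nondecreasing, this sum is
  largest for \<open>t = 1\<close>, and for \<open>s = f_seq l r\<close> even that value is smaller than \<open>2 ^ l\<close>.
\<close>

section \<open>Cyclic positions and sums over initial segments\<close>

text \<open>Listing the values in index order gives a sorted list without repetitions, and such a
  list is determined by its set of entries.\<close>

lemma strict_mono_on_image_unique: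
  fixes f g :: "nat \<Rightarrow> 'a::linorder"
  assumes "strict_mono_on {..<m} f" and "strict_mono_on {..<m} g"
    and "f ` {..<m} = g ` {..<m}" and "k < m"
  shows "f k = g k"
proof -
  have sd: "sorted (map h [0..<m]) \<and> distinct (map h [0..<m])"
    if h: "strict_mono_on {..<m} h" for h :: "nat \<Rightarrow> 'a"
  proof -
    have "inj_on h {..<m}"
      using h by (rule strict_mono_on_imp_inj_on)
    moreover have "h i \<le> h j" if "i \<le> j" "j < m" for i j
      using strict_mono_onD[OF h, of i j] that by (cases "i = j") auto
    ultimately show ?thesis
      by (auto simp: sorted_iff_nth_mono distinct_map atLeast0LessThan)
  qed
  have "map f [0..<m] = map g [0..<m]"
    using sd[OF assms(1)] sd[OF assms(2)] assms(3)
    by (intro sorted_distinct_set_unique) (auto simp: atLeast0LessThan)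
  then show ?thesis
    using \<open>k < m\<close> by (auto dest!: arg_cong[where f = "\<lambda>xs. xs ! k"])
qed

text \<open>The start \<open>q\<close> is the \<open>t\<close>-th position of the first sequence.
  Rereading that sequence from \<open>q\<close> gives increasing offsets with the same image as
  \<open>B\<close>, hence equal to \<open>B\<close>. For \<open>t > 0\<close> the two arcs in
  \<open>gaps\<close> would then close up to a full turn of length \<open>n\<close>.\<close>

lemma cyclic_positions_unique:
  fixes A B :: "nat \<Rightarrow> int"
  assumes A: "strict_mono_on {..<m} A" "A 0 = 0" "\<And>k. k < m \<Longrightarrow> A k < n"
    and B: "strict_mono_on {..<m} B" "B 0 = 0" "\<And>k. k < m \<Longrightarrow> B k < n"
    and p: "0 \<le> p" "p < n" and q: "0 \<le> q" "q < n"
    and eq: "(\<lambda>k. (p + A k) mod n) ` {..<m} = (\<lambda>k. (q + B k) mod n) ` {..<m}"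
    and gaps: "\<And>t. 0 < t \<Longrightarrow> t < m \<Longrightarrow> (A (m - 1) - A (t - 1)) + (B (m - 1) - B (m - t - 1)) \<noteq> n"
    and m: "0 < m"
  shows "p = q" and "\<And>k. k < m \<Longrightarrow> A k = B k"
proof -
  have nonneg: "0 \<le> h k" if "strict_mono_on {..<m} h" "h 0 = 0" "k < m" for h :: "nat \<Rightarrow> int" and k
    using strict_mono_onD[OF that(1), of 0 k] that by (cases "k = 0") auto
  have "q \<in> (\<lambda>k. (q + B k) mod n) ` {..<m}"
    using m B(2) q by (auto intro!: image_eqI[of _ _ 0])
  then obtain t where t: "t < m" "q = (p + A t) mod n"
    unfolding eq[symmetric] by auto
  \<comment> \<open>Offsets of the first sequence as seen from \<open>q\<close>: the positions with
    index below \<open>t\<close> are met only after passing the origin, hence the added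
    \<open>n\<close>.\<close>
  define B' where "B' i = (if i < m - t then A (t + i) - A t else n + A (i - (m - t)) - A t)" for i
  have B'_range: "0 \<le> B' i \<and> B' i < n" if "i < m" for i
  proof (cases "i < m - t")
    case True
    then have "A t \<le> A (t + i)"
      using strict_mono_onD[OF A(1), of t "t + i"] t by (cases "i = 0") (auto intro: less_imp_le)
    moreover have "A (t + i) < n" "0 \<le> A t"
      using True A(3) nonneg[OF A(1,2)] t by auto
    ultimately show ?thesis
      using True by (simp add: B'_def)
  next
    case False
    then have "A (i - (m - t)) < A t"
      using strict_mono_onD[OF A(1), of "i - (m - t)" t] t that by auto
    moreover have "0 \<le> A (i - (m - t))" "A t < n"
      using False A(3) nonneg[OF A(1,2)] t that by auto
    ultimately show ?thesis
      using False by (simp add: B'_def)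
  qed
  have B'_mono: "strict_mono_on {..<m} B'"
  proof (rule strict_mono_onI)
    fix i j assume ij: "i \<in> {..<m}" "j \<in> {..<m}" "i < j"
    consider "j < m - t" | "i < m - t" "\<not> j < m - t" | "\<not> i < m - t" by linarith
    then show "B' i < B' j"
    proof cases
      case 1
      then show ?thesis
        using strict_mono_onD[OF A(1), of "t + i" "t + j"] ij by (simp add: B'_def)
    next
      case 2
      then have "A (t + i) < n" "0 \<le> A (j - (m - t))"
        using A(3) nonneg[OF A(1,2)] ij t by auto
      then show ?thesis
        using 2 by (simp add: B'_def)
    next
      case 3
      then show ?thesis
        using strict_mono_onD[OF A(1), of "i - (m - t)" "j - (m - t)"] ij t by (simp add: B'_def)
    qed
  qed
  have B'_cong: "(q + B' i) mod n = (p + A ((t + i) mod m)) mod n" if "i < m" for i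
  proof (cases "i < m - t")
    case True
    then have "(q + B' i) mod n = (p + A t + (A (t + i) - A t)) mod n"
      unfolding t(2) B'_def by (simp only: mod_add_left_eq if_True)
    then show ?thesis
      using True by simp
  next
    case False
    then have "(q + B' i) mod n = (p + A t + (n + A (i - (m - t)) - A t)) mod n"
      unfolding t(2) B'_def by (simp only: mod_add_left_eq if_False)
    also have "\<dots> = (p + A (i - (m - t)) + n) mod n"
      by (simp add: algebra_simps)
    also have "i - (m - t) = (t + i) mod m"
      using False that t by (simp add: le_mod_geq)
    finally show ?thesis
      by simp
  qed
  have rot: "(\<lambda>i. (t + i) mod m) ` {..<m} = {..<m}"
  proof (rule card_subset_eq)
    have "inj_on (\<lambda>i. (t + i) mod m) {..<m}"
    proof (rule inj_onI)
      fix i j assume ij: "i \<in> {..<m}" "j \<in> {..<m}" "(t + i) mod m = (t + j) mod m"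
      then show "i = j"
        using t by (auto simp: mod_if split: if_splits)
    qed
    then show "card ((\<lambda>i. (t + i) mod m) ` {..<m}) = card {..<m}"
      by (rule card_image)
  qed (use m in auto)
  have "(\<lambda>k. (q + B k) mod n) ` {..<m} = (\<lambda>i. (p + A i) mod n) ` (\<lambda>i. (t + i) mod m) ` {..<m}"
    unfolding rot eq ..
  also have "\<dots> = (\<lambda>i. (q + B' i) mod n) ` {..<m}"
    unfolding image_image by (rule image_cong) (auto simp: B'_cong)
  finally have img: "(\<lambda>k. (q + B k) mod n) ` {..<m} = (\<lambda>i. (q + B' i) mod n) ` {..<m}" .
  \<comment> \<open>Offsets in \<open>[0, n)\<close> are recovered from the residues by subtracting
    \<open>q\<close> and reducing again.\<close>
  have undo: "h ` {..<m} = (\<lambda>z. (z - q) mod n) ` (\<lambda>k. (q + h k) mod n) ` {..<m}"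
    if "\<And>k. k < m \<Longrightarrow> 0 \<le> h k \<and> h k < n" for h :: "nat \<Rightarrow> int"
    unfolding image_image by (rule image_cong) (use that in \<open>auto simp: mod_diff_left_eq\<close>)
  have "B ` {..<m} = B' ` {..<m}"
    using undo[of B] undo[of B'] B'_range nonneg[OF B(1,2)] B(3) img by simp
  then have BB': "B k = B' k" if "k < m" for k
    using strict_mono_on_image_unique[OF B(1) B'_mono] that by blast
  have "t = 0"
  proof (rule ccontr)
    assume "t \<noteq> 0"
    \<comment> \<open>Seen from \<open>q\<close>, the last position is the predecessor of
      \<open>q\<close>, with old index \<open>t - 1\<close>; the old last position gets index
      \<open>m - t - 1\<close>.\<close>
    have "B (m - 1) = n + A (t - 1) - A t" "B (m - t - 1) = A (m - 1) - A t"
      using \<open>t \<noteq> 0\<close> t m by (auto simp: BB' B'_def)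
    then show False
      using gaps[of t] \<open>t \<noteq> 0\<close> t by simp
  qed
  then show "p = q"
    using t A(2) p by simp
  show "A k = B k" if "k < m" for k
    using BB'[OF that] that A(2) \<open>t = 0\<close> by (simp add: B'_def)
qed

text \<open>Shifting the terms \<open>2..t\<close> of the second segment up by
  \<open>m - t - 1\<close> does not decrease them and fills exactly the indices missing from the
  first segment; only \<open>F 1\<close> is left over.\<close>

lemma sum_initial_segments_le:
  fixes F :: "nat \<Rightarrow> nat"
  assumes "mono_on {1..<m} F" and "0 < t" and "t < m"
  shows "sum F {1..<m - t + 1} + sum F {1..<t + 1} \<le> sum F {1..<m} + F 1"
proof -
  have "sum F {1..<t + 1} = F 1 + sum F {2..<t + 1}"
    using assms(2) by (simp add: sum.atLeast_Suc_lessThan numeral_2_eq_2 del: sum.op_ivl_Suc)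
  also have "sum F {2..<t + 1} \<le> (\<Sum>i\<in>{2..<t + 1}. F (i + (m - t - 1)))"
    using assms by (intro sum_mono mono_onD[OF assms(1)]) auto
  also have "\<dots> = sum F {m - t + 1..<m}"
    using assms sum.shift_bounds_nat_ivl[of F 2 "m - t - 1" "t + 1"]
    by (simp add: numeral_2_eq_2 Suc_diff_Suc)
  finally have "sum F {1..<t + 1} \<le> F 1 + sum F {m - t + 1..<m}"
    by simp
  moreover have "sum F {1..<m - t + 1} + sum F {m - t + 1..<m} = sum F {1..<m}"
    using assms by (intro sum.atLeastLessThan_concat) auto
  ultimately show ?thesis
    by simp
qed

section \<open>Decimal values and the splitting into blocks\<close>

lemma horner_sum_of_bool_less:
  "horner_sum of_bool 2 y < (2::nat) ^ length y"
  by (induction y) (auto simp: of_bool_def)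

lemma dec_less: "dec y < 2 ^ length y"
  using horner_sum_of_bool_less[of "rev y"] by (simp add: dec_def)

lemma dec_inject:
  assumes "length y = length z" and "dec y = dec z"
  shows "y = z"
proof -
  have "u = v" if "length u = length v" "horner_sum of_bool 2 u = (horner_sum of_bool 2 v :: nat)"
    for u v :: "bool list"
    using that
  proof (induction u v rule: list_induct2)
    case (Cons b u c v)
    \<comment> \<open>The head is the least significant bit, so parity separates it from the
      rest.\<close>
    from Cons.prems have "b = c \<and> horner_sum of_bool 2 u = (horner_sum of_bool 2 v :: nat)"
      by (cases b; cases c) (simp_all, presburger+)
    then show ?case
      using Cons.IH by simp
  qed simp
  from this[of "rev y" "rev z"] show ?thesis
    using assms by (simp add: dec_def)
qed

text \<open>Induction on the number \<open>k\<close> of blocks read from the front: these are the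
  blocks \<open>l, ..., l - k + 1\<close>, and their total length is the offset at which block
  \<open>l - k\<close> starts.\<close>

lemma blocks_determine:
  assumes len: "length x = (\<Sum>i=1..l. s i)" "length y = (\<Sum>i=1..l. s i)"
    and blocks: "\<And>j. 1 \<le> j \<Longrightarrow> j \<le> l \<Longrightarrow> block s l x j = block s l y j"
  shows "x = y"
proof -
  have "take (\<Sum>i=Suc (l - k)..l. s i) x = take (\<Sum>i=Suc (l - k)..l. s i) y" if "k \<le> l" for k
    using that
  proof (induction k)
    case (Suc k)
    let ?j = "l - k"
    have "(\<Sum>i=Suc (l - Suc k)..l. s i) = (\<Sum>i=Suc ?j..l. s i) + s ?j"
      using Suc.prems by (simp add: Suc_diff_Suc sum.atLeast_Suc_atMost)
    then show ?case
      using Suc blocks[of ?j] by (simp add: take_add block_def)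
  qed simp
  from this[of l] show ?thesis
    using len by simp
qed

section \<open>The set of positions written by the encoder\<close>

lemma fold_enc_step:
  assumes "length c = 2 ^ l"
  shows "length (fst (fold (enc_step s l x) js (c, q))) = 2 ^ l"
    and "i < 2 ^ l \<Longrightarrow> fst (fold (enc_step s l x) js (c, q)) ! i \<longleftrightarrow> c ! i \<or>
      (\<exists>k<length js. int i = (q + (\<Sum>m\<le>k. 1 + int (dec (block s l x (js ! m))))) mod 2 ^ l)"
proof -
  have "length (fst (fold (enc_step s l x) js (c, q))) = 2 ^ l \<and>
    (\<forall>i<2 ^ l. fst (fold (enc_step s l x) js (c, q)) ! i \<longleftrightarrow> c ! i \<or>
      (\<exists>k<length js. int i = (q + (\<Sum>m\<le>k. 1 + int (dec (block s l x (js ! m))))) mod 2 ^ l))"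
    using assms
  proof (induction js arbitrary: c q)
    case (Cons j js)
    define d where "d j = 1 + int (dec (block s l x j))" for j
    define q' where "q' = (q + d j) mod 2 ^ l"
    have step: "enc_step s l x j (c, q) = (c[nat q' := True], q')"
      by (simp add: enc_step_def Let_def q'_def d_def add.assoc)
    have q': "0 \<le> q'" "nat q' < 2 ^ l"
      by (simp_all add: q'_def nat_less_iff)
    \<comment> \<open>Reducing the position after each step or only once at the end gives the same
      residue.\<close>
    have shift: "(q' + (\<Sum>m\<le>k. d (js ! m))) mod 2 ^ l =
        (q + (\<Sum>m\<le>Suc k. d ((j # js) ! m))) mod 2 ^ l" for k
      unfolding sum.atMost_Suc_shift by (simp add: q'_def mod_add_left_eq add.assoc)
    have ex: "(\<exists>k<length (j # js). P k) \<longleftrightarrow> P 0 \<or> (\<exists>k<length js. P (Suc k))" for P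
      by (auto simp: less_Suc_eq_0_disj)
    have upd: "c[nat q' := True] ! i \<longleftrightarrow> c ! i \<or> int i = q'" if "i < 2 ^ l" for i
      using that q' Cons.prems by (auto simp: nth_list_update)
    show ?case
      using Cons.IH[of "c[nat q' := True]" q'] Cons.prems upd shift
      unfolding fold_simps comp_apply step d_def[symmetric] ex
      by (auto simp: q'_def)
  qed simp
  then show "length (fst (fold (enc_step s l x) js (c, q))) = 2 ^ l"
    and "i < 2 ^ l \<Longrightarrow> fst (fold (enc_step s l x) js (c, q)) ! i \<longleftrightarrow> c ! i \<or>
      (\<exists>k<length js. int i = (q + (\<Sum>m\<le>k. 1 + int (dec (block s l x (js ! m))))) mod 2 ^ l)"
    by blast+
qed

lemma length_phi: "length (phi s l x) = 2 ^ l"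
  unfolding phi_def by (rule fold_enc_step) simp

text \<open>Distance, before reduction modulo \<open>2 ^ l\<close>, from the first written position
  to the one written \<open>k\<close> steps later. Block \<open>l\<close> is left out because it
  only fixes the first position.\<close>

definition gap_sum :: "(nat \<Rightarrow> nat) \<Rightarrow> nat \<Rightarrow> bool list \<Rightarrow> nat \<Rightarrow> int" where
  "gap_sum s l x k = (\<Sum>i\<in>{l - k..<l}. 1 + int (dec (block s l x i)))"

lemma gap_sum_0: "gap_sum s l x 0 = 0"
  by (simp add: gap_sum_def)

lemma gap_sum_diff:
  assumes "i \<le> j" and "j \<le> l"
  shows "gap_sum s l x j - gap_sum s l x i = (\<Sum>u\<in>{l - j..<l - i}. 1 + int (dec (block s l x u)))"
proof -
  have "(\<Sum>u\<in>{l - j..<l - i}. 1 + int (dec (block s l x u))) + gap_sum s l x i = gap_sum s l x j"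
    unfolding gap_sum_def using assms by (intro sum.atLeastLessThan_concat) auto
  then show ?thesis
    by simp
qed

lemma gap_sum_Suc:
  assumes "k < l"
  shows "gap_sum s l x (Suc k) = gap_sum s l x k + 1 + int (dec (block s l x (l - Suc k)))"
proof -
  have "{l - Suc k..<l - k} = {l - Suc k}"
    using assms by auto
  then show ?thesis
    using gap_sum_diff[of k "Suc k" l s x] assms by simp
qed

lemma gap_sum_strict_mono: "strict_mono_on {..<l} (gap_sum s l x)"
proof (rule strict_mono_onI)
  fix i j assume "i \<in> {..<l}" "j \<in> {..<l}" "i < j"
  then have "0 < (\<Sum>u\<in>{l - j..<l - i}. 1 + int (dec (block s l x u)))"
    by (intro sum_pos) auto
  then show "gap_sum s l x i < gap_sum s l x j"
    using gap_sum_diff[of i j l s x] \<open>i < j\<close> \<open>j \<in> {..<l}\<close> by simp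
qed

lemma gap_sum_diff_le:
  assumes "i \<le> j" and "j \<le> l"
  shows "gap_sum s l x j - gap_sum s l x i \<le> int (\<Sum>u\<in>{l - j..<l - i}. 2 ^ s u)"
proof -
  have "1 + int (dec (block s l x u)) \<le> int (2 ^ s u)" for u
  proof -
    have "dec (block s l x u) < 2 ^ length (block s l x u)"
      by (rule dec_less)
    \<comment> \<open>Only an inequality, since \<open>take\<close> yields a shorter block when
      \<open>x\<close> is too short.\<close>
    also have "\<dots> \<le> 2 ^ s u"
      by (rule power_increasing) (auto simp: block_def)
    finally show ?thesis
      by linarith
  qed
  then show ?thesis
    unfolding gap_sum_diff[OF assms] of_nat_sum by (intro sum_mono)
qed

lemma True_positions_phi:
  assumes "0 < l"
  shows "int ` {i. i < 2 ^ l \<and> phi s l x ! i} =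
    (\<lambda>k. (int (dec (block s l x l)) + gap_sum s l x k) mod 2 ^ l) ` {..<l}"
proof -
  have js: "rev [1..<l + 1] ! m = l - m" if "m < l" for m
    using that by (subst rev_nth) (auto simp del: upt_Suc simp: nth_upt)
  \<comment> \<open>The initial position -1 cancels the increment of the first step, so the first
    position is the value of block \<open>l\<close> itself.\<close>
  have pos: "-1 + (\<Sum>m\<le>k. 1 + int (dec (block s l x (rev [1..<l + 1] ! m)))) =
      int (dec (block s l x l)) + gap_sum s l x k" if "k < l" for k
    using that
  proof (induction k)
    case 0
    then show ?case
      using js[of 0] by (simp add: gap_sum_0 del: upt_Suc)
  next
    case (Suc k)
    then show ?case
      using js[of "Suc k"] by (simp add: gap_sum_Suc del: upt_Suc)
  qed
  have "phi s l x ! i \<longleftrightarrow>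
      (\<exists>k<l. int i = (int (dec (block s l x l)) + gap_sum s l x k) mod 2 ^ l)"
    if "i < 2 ^ l" for i
    unfolding phi_def
    using fold_enc_step(2)[of "replicate (2 ^ l) False" l i s x "rev [1..<l + 1]" "-1"] that pos
    by (auto simp del: upt_Suc)
  moreover have "\<exists>i<2 ^ l. int i = z mod 2 ^ l" for z :: int
    by (rule exI[of _ "nat (z mod 2 ^ l)"]) (simp add: nat_less_iff)
  ultimately show ?thesis
    by (fastforce simp: image_iff)
qed

section \<open>A criterion for injectivity\<close>

text \<open>The hypothesis \<open>total\<close> is the extremal case \<open>t = 1\<close> of the
  rotation bound, and it also keeps all offsets below \<open>2 ^ l\<close>. Block \<open>l\<close>
  yields the starting position rather than a gap, so it is only required to satisfy
  \<open>s l \<le> l\<close>.\<close>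

theorem phi_inj_on:
  assumes l: "0 < l" and s_l: "s l \<le> l" and mono: "mono_on {1..<l} s"
    and total: "(\<Sum>i\<in>{1..<l}. 2 ^ s i) + 2 ^ s 1 < (2 ^ l :: nat)"
  shows "inj_on (phi s l) (binvecs (\<Sum>i=1..l. s i))"
proof (rule inj_onI)
  fix x y
  assume "x \<in> binvecs (\<Sum>i=1..l. s i)" "y \<in> binvecs (\<Sum>i=1..l. s i)" and eq: "phi s l x = phi s l y"
  then have len: "length x = (\<Sum>i=1..l. s i)" "length y = (\<Sum>i=1..l. s i)"
    by (simp_all add: binvecs_def)
  have first: "int (dec (block s l z l)) < 2 ^ l" for z
  proof -
    have "dec (block s l z l) < 2 ^ length (block s l z l)"
      by (rule dec_less)
    also have "\<dots> \<le> 2 ^ l"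
      using s_l by (intro power_increasing) (auto simp: block_def)
    finally show ?thesis
      by (metis of_nat_less_iff of_nat_numeral of_nat_power)
  qed
  have bound: "gap_sum s l z k < 2 ^ l" if "k < l" for z k
  proof -
    have "gap_sum s l z k \<le> int (\<Sum>u\<in>{l - k..<l}. 2 ^ s u)"
      using gap_sum_diff_le[of 0 k l s z] that by (simp add: gap_sum_0)
    also have "\<dots> \<le> int (\<Sum>u\<in>{1..<l}. 2 ^ s u)"
      using that by (intro of_nat_mono sum_mono2) auto
    also have "\<dots> < int (2 ^ l)"
      using total by linarith
    finally show ?thesis
      by simp
  qed
  have mono_pow: "mono_on {1..<l} (\<lambda>i. (2::nat) ^ s i)"
    using mono by (auto simp: mono_on_def)
  \<comment> \<open>Both arcs end at the last position, so their gaps come from the blocks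
    \<open>1..l - t\<close> and \<open>1..t\<close>: two initial segments.\<close>
  have no_rotation: "(gap_sum s l x (l - 1) - gap_sum s l x (t - 1)) +
      (gap_sum s l y (l - 1) - gap_sum s l y (l - t - 1)) \<noteq> 2 ^ l" if "0 < t" "t < l" for t
  proof -
    have "gap_sum s l x (l - 1) - gap_sum s l x (t - 1) \<le> int (\<Sum>u\<in>{1..<l - t + 1}. 2 ^ s u)"
      using gap_sum_diff_le[of "t - 1" "l - 1" l s x] that by (simp add: Suc_diff_le)
    moreover have "gap_sum s l y (l - 1) - gap_sum s l y (l - t - 1) \<le> int (\<Sum>u\<in>{1..<t + 1}. 2 ^ s u)"
      using gap_sum_diff_le[of "l - t - 1" "l - 1" l s y] that by simp
    ultimately have "(gap_sum s l x (l - 1) - gap_sum s l x (t - 1)) +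
      (gap_sum s l y (l - 1) - gap_sum s l y (l - t - 1)) < int (2 ^ l)"
      using sum_initial_segments_le[OF mono_pow that] total by linarith
    then show ?thesis
      by simp
  qed
  have positions: "(\<lambda>k. (int (dec (block s l x l)) + gap_sum s l x k) mod 2 ^ l) ` {..<l} =
      (\<lambda>k. (int (dec (block s l y l)) + gap_sum s l y k) mod 2 ^ l) ` {..<l}"
    using True_positions_phi[OF l] eq by metis
  have "int (dec (block s l x l)) = int (dec (block s l y l))"
    by (rule cyclic_positions_unique(1)) (rule gap_sum_strict_mono gap_sum_0 bound of_nat_0_le_iff
      first positions no_rotation l | assumption)+
  then have start: "dec (block s l x l) = dec (block s l y l)"
    by simp
  have gaps: "gap_sum s l x k = gap_sum s l y k" if "k < l" for k
    using that
    by (rule cyclic_positions_unique(2)[rotated -1]) (rule gap_sum_strict_mono gap_sum_0 bound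
      of_nat_0_le_iff first positions no_rotation l | assumption)+
  have "block s l x j = block s l y j" if "1 \<le> j" "j \<le> l" for j
  proof (rule dec_inject)
    show "length (block s l x j) = length (block s l y j)"
      using len by (simp add: block_def)
    show "dec (block s l x j) = dec (block s l y j)"
    \<comment> \<open>Block \<open>l\<close> is read off the starting position; any other block
      \<open>j\<close> is the gap between the offsets with indices \<open>l - j - 1\<close> and
      \<open>l - j\<close>.\<close>
    proof (cases "j = l")
      case False
      then show ?thesis
        using gap_sum_Suc[of "l - Suc j" l s x] gap_sum_Suc[of "l - Suc j" l s y] that
          gaps[of "l - j"] gaps[of "l - Suc j"]
        by (simp add: Suc_diff_Suc)
    qed (use start in simp)
  qed
  then show "x = y"
    using blocks_determine[OF len] by blast
qed

section \<open>Monotonicity and power sums of \<open>f_seq\<close>\<close>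

lemma f_seq_third_range:
  assumes "l - 2 * r \<le> i" and "2 * r < l" and "i < l"
  shows "f_seq l r i = l - 1 - (l - i + 1) div 2"
proof -
  have "\<lceil>(real l - real i) / 2\<rceil> = int ((l - i + 1) div 2)"
  proof (rule ceiling_unique)
    define d where "d = (l - i + 1) div 2"
    have "l \<le> i + 2 * d" "i + 2 * d < l + 2"
      using assms(3) unfolding d_def by linarith+
    then have "real l \<le> real (i + 2 * d)" "real (i + 2 * d) < real (l + 2)"
      by (simp_all only: of_nat_le_iff of_nat_less_iff)
    then show "(real l - real i) / 2 \<le> of_int (int ((l - i + 1) div 2))"
      "of_int (int ((l - i + 1) div 2)) - 1 < (real l - real i) / 2"
      unfolding d_def[symmetric] by simp_all
  qed
  then have c: "nat \<lceil>(real l - real i) / 2\<rceil> = (l - i + 1) div 2"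
    by simp
  show ?thesis
  \<comment> \<open>The first clause of \<open>f_seq\<close> takes precedence at
    \<open>i = 1\<close>. There \<open>l = 2 * r + 1\<close> and \<open>delta l r = 0\<close>, so
    both formulas give \<open>r\<close>.\<close>
  proof (cases "i = 1")
    case True
    then have "l = 2 * r + 1"
      using assms by linarith
    then show ?thesis
      using True by (simp add: f_seq_def delta_def)
  qed (use assms c in \<open>auto simp: f_seq_def\<close>)
qed

lemma f_seq_second_range:
  assumes "2 \<le> i" and "i < l - 2 * r"
  shows "f_seq l r i = r + i - 1"
  using assms by (auto simp: f_seq_def)

lemma f_seq_1: "f_seq l r 1 = r + delta l r"
  by (simp add: f_seq_def)

text \<open>Across the boundary at \<open>l - 2 * r\<close>, the value \<open>l - 1 - r\<close>
  separates the ranges: it is a lower bound from there on and an upper bound before.\<close>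

lemma f_seq_mono:
  assumes "2 * r < l"
  shows "mono_on {1..<l} (f_seq l r)"
proof (rule mono_onI)
  fix i j assume ij: "i \<in> {1..<l}" "j \<in> {1..<l}" "i \<le> j"
  consider "i = 1" "j = 1" | "i = 1" "2 \<le> j" "j < l - 2 * r" | "2 \<le> i" "j < l - 2 * r"
    | "i = 1" "i < l - 2 * r" "l - 2 * r \<le> j" | "2 \<le> i" "i < l - 2 * r" "l - 2 * r \<le> j"
    | "l - 2 * r \<le> i"
    using ij by force
  then show "f_seq l r i \<le> f_seq l r j"
  proof cases
    case 4
    then have "l - 1 - (l - j + 1) div 2 \<ge> l - 1 - r"
      using ij by (intro diff_le_mono2) linarith
    moreover have "r + delta l r \<le> l - 1 - r"
      using 4 unfolding delta_def by (auto split: if_splits)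
    ultimately show ?thesis
      using 4 ij f_seq_third_range[of l r j] assms unfolding \<open>i = 1\<close> f_seq_1 by simp
  next
    case 5
    then have "l - 1 - (l - j + 1) div 2 \<ge> l - 1 - r"
      using ij by (intro diff_le_mono2) linarith
    moreover have "r + i - 1 \<le> l - 1 - r"
      using 5 by linarith
    ultimately show ?thesis
      using 5 ij f_seq_third_range[of l r j] f_seq_second_range[of i l r] assms by simp
  next
    case 6
    then show ?thesis
      using ij f_seq_third_range[of l r] assms by (auto intro!: diff_le_mono2 div_le_mono)
  qed (use ij in \<open>auto simp: f_seq_1[unfolded One_nat_def] f_seq_second_range delta_def\<close>)
qed

text \<open>Read downwards from \<open>l - 1\<close>, the values come in equal pairs, and each pair
  contributes exactly half of what is still missing from \<open>2 ^ l\<close>.\<close>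

lemma sum_f_seq_third_range:
  assumes "2 * r < l" and "u \<le> r"
  shows "(\<Sum>i\<in>{l - 2 * u..<l}. 2 ^ f_seq l r i) + 2 ^ (l - u) = (2 ^ l :: nat)"
  using assms(2)
proof (induction u)
  case (Suc u)
  define a where "a = l - 2 * Suc u"
  have a: "l = a + 2 * Suc u" "l - 2 * u = Suc (Suc a)"
    using assms(1) Suc.prems by (simp_all add: a_def)
  have "f_seq l r a = l - 2 - u" "f_seq l r (Suc a) = l - 2 - u"
    using f_seq_third_range[of l r a] f_seq_third_range[of l r "Suc a"] assms(1) Suc.prems a
    by auto
  moreover have "l - u = Suc (Suc (l - 2 - u))" "l - Suc u = Suc (l - 2 - u)"
    using a by simp_all
  moreover have "(\<Sum>i\<in>{a..<l}. 2 ^ f_seq l r i) =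
      2 ^ f_seq l r a + 2 ^ f_seq l r (Suc a) + (\<Sum>i\<in>{Suc (Suc a)..<l}. 2 ^ f_seq l r i :: nat)"
    using a by (simp add: sum.atLeast_Suc_lessThan)
  ultimately show ?case
    using Suc a unfolding a_def[symmetric] by simp
qed simp

text \<open>A geometric sum with ratio 2 starting at \<open>2 ^ (r + 1)\<close>, stated additively
  to avoid subtraction.\<close>

lemma sum_f_seq_second_range:
  assumes "2 + k \<le> l - 2 * r"
  shows "(\<Sum>i\<in>{2..<2 + k}. 2 ^ f_seq l r i) + 2 ^ (r + 1) = (2 ^ (r + 1 + k) :: nat)"
  using assms
proof (induction k)
  case (Suc k)
  then show ?case
    using f_seq_second_range[of "2 + k" l r] by simp
qed simp

text \<open>The third range leaves room \<open>2 ^ (l - r)\<close>. If the second range is nonempty,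
  it uses \<open>2 ^ (l - r - 1) - 2 ^ (r + 1)\<close> of it, and two copies of
  \<open>2 ^ (r + 1)\<close> for index 1 still fit strictly. Otherwise \<open>l\<close> is
  \<open>2 * r + 1\<close> or \<open>2 * r + 2\<close>, and at most two copies of
  \<open>2 ^ r\<close> are to be placed.\<close>

lemma sum_f_seq_less:
  assumes "1 \<le> r" and "2 * r < l"
  shows "(\<Sum>i\<in>{1..<l}. 2 ^ f_seq l r i) + 2 ^ f_seq l r 1 < (2 ^ l :: nat)"
proof -
  define T :: nat where "T = (\<Sum>i\<in>{l - 2 * r..<l}. 2 ^ f_seq l r i)"
  have T: "T + 2 ^ (l - r) = 2 ^ l"
    unfolding T_def by (rule sum_f_seq_third_range) (use assms in auto)
  consider "l = 2 * r + 1" | "l = 2 * r + 2" | k where "l = 2 * r + 3 + k"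
    using assms by atomize_elim presburger
  then show ?thesis
  proof cases
    case 1
    then have "l - 2 * r = 1" "l - r = r + 1"
      by simp_all
    then have "(\<Sum>i\<in>{1..<l}. 2 ^ f_seq l r i) = T" "(2::nat) ^ (l - r) = 2 * 2 ^ r"
      by (simp_all add: T_def)
    moreover have "f_seq l r 1 = r"
      using f_seq_1[of l r] 1 by (simp add: delta_def)
    moreover have "T + 2 ^ r < T + 2 * 2 ^ r"
      by simp
    ultimately show ?thesis
      using T by metis
  next
    case 2
    then have "l - 2 * r = 2" "l - r = r + 2" "1 < l"
      using assms by simp_all
    then have "(\<Sum>i\<in>{1..<l}. 2 ^ f_seq l r i) = 2 ^ f_seq l r 1 + T" "(2::nat) ^ (l - r) = 4 * 2 ^ r"
      by (simp_all add: T_def sum.atLeast_Suc_lessThan numeral_2_eq_2)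
    moreover have "f_seq l r 1 = r"
      using f_seq_1[of l r] 2 by (simp add: delta_def)
    moreover have "2 ^ r + T + 2 ^ r < T + 4 * 2 ^ r"
      by simp
    ultimately show ?thesis
      using T by metis
  next
    case 3
    then have k: "l - 2 * r = 3 + k" "2 \<le> 3 + k" "3 + k \<le> l"
      by simp_all
    define M :: nat where "M = (\<Sum>i\<in>{2..<3 + k}. 2 ^ f_seq l r i)"
    have "(\<Sum>i\<in>{1..<l}. 2 ^ f_seq l r i :: nat) = 2 ^ f_seq l r 1 + (\<Sum>i\<in>{2..<l}. 2 ^ f_seq l r i)"
      using assms by (simp add: sum.atLeast_Suc_lessThan numeral_2_eq_2)
    also have "(\<Sum>i\<in>{2..<l}. 2 ^ f_seq l r i) = M + T"
      unfolding M_def T_def k(1) using sum.atLeastLessThan_concat[OF k(2,3)] by metis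
    finally have split: "(\<Sum>i\<in>{1..<l}. 2 ^ f_seq l r i) = 2 ^ f_seq l r 1 + (M + T)" .
    have "M + 2 ^ (r + 1) = 2 ^ (r + 2 + k)"
    proof -
      have "2 + Suc k = 3 + k" "r + 1 + Suc k = r + 2 + k"
        by simp_all
      then show ?thesis
        unfolding M_def using sum_f_seq_second_range[of "Suc k" l r] k(1) by (metis le_refl)
    qed
    moreover have "(2::nat) ^ (l - r) = 2 * 2 ^ (r + 2 + k)"
      using 3 by (simp add: power_add)
    moreover have "(2::nat) ^ (r + 1) < 2 ^ (r + 2 + k)"
      by (rule power_strict_increasing) auto
    moreover have f_1: "f_seq l r 1 = r + 1"
      using f_seq_1[of l r] 3 by (simp add: delta_def)
    ultimately show ?thesis
      using T unfolding split f_1 by linarith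
  qed
qed

theorem theorem3p3:
  fixes l r :: nat
  assumes "l \<ge> 3" and "1 \<le> r" and "r \<le> (l + 3) div 4"
  shows "phi (f_seq l r) l ` binvecs (k_sum l r) \<subseteq> binvecs (2 ^ l) \<and>
         inj_on (phi (f_seq l r) l) (binvecs (k_sum l r))"
proof
  show "phi (f_seq l r) l ` binvecs (k_sum l r) \<subseteq> binvecs (2 ^ l)"
    by (auto simp: binvecs_def length_phi)
  \<comment> \<open>From \<open>4 * r \<le> l + 3\<close>: for \<open>l > 3\<close> half of
    \<open>l + 3\<close> is below \<open>l\<close>, and for \<open>l = 3\<close> integrality forces
    \<open>r = 1\<close>.\<close>
  have r: "2 * r < l"
    using assms by presburger
  show "inj_on (phi (f_seq l r) l) (binvecs (k_sum l r))"
    unfolding k_sum_def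
  proof (rule phi_inj_on)
    show "f_seq l r l \<le> l"
      using assms r by (simp add: f_seq_def)
  qed (use assms(1) f_seq_mono[OF r] sum_f_seq_less[OF assms(2) r] in auto)
qed

end
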